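(* Let $\mathbf u,\mathbf v$ be sequences of non-zero scalars, and let $\mu_{\mathbf u}=\bigotimes_{n\ge0}\mu_{\mathbf u,n}$ and $\mu_{\mathbf v}=\bigotimes_{n\ge0}\mu_{\mathbf v,n}$ be Gaussian product measures on $\mathbb K^{\mathbb Z_+}$ which are invariant under $B_{\mathbf u}$ and $B_{\mathbf v}$ respectively, with $\mu_{\mathbf u,0}=\mathcal N(0,\sigma^2)$ and $\mu_{\mathbf v,0}=\mathcal N(0,\sigma'^2)$ ($\sigma,\sigma'>0$). Then $\mu_{\mathbf u}$ and $\mu_{\mathbf v}$ are either equivalent or mutually singular, and they are equivalent if and only if $$\sum_{n=1}^\infty\left(1-\frac{\sigma'}{\sigma}\,\frac{|u_1\cdots u_n|}{|v_1\cdots v_n|}\right)^2<\infty.$$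
   Context: $\mathbb K\in\{\mathbb R,\mathbb C\}$. For $\sigma>0$, $\mathcal N(0,\sigma^2)$ denotes the centered Gaussian measure on $\mathbb K$ with covariance matrix $\sigma^2 I_{\mathbb K}$ (identifying $\mathbb C$ with $\mathbb R^2$ in the complex case). A Gaussian product measure on $\mathbb K^{\mathbb Z_+}$ is a product $\bigotimes_{n\ge0}\mu_n$ with each $\mu_n=\mathcal N(0,\sigma_n^2)$ for some $\sigma_n>0$. $B_{\mathbf w}:\mathbb K^{\mathbb Z_+}\to\mathbb K^{\mathbb Z_+}$ is $(B_{\mathbf w}t)_j=w_{j+1}t_{j+1}$, and invariance means $\mu(B_{\mathbf w}^{-1}B)=\mu(B)$ for Borel $B$ (product topology). *)

theory Defs
  imports "HOL-Probability.Probability"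
begin

text \<open>Scalars: a type 'a of class real_normed_field and euclidean_space
  (i.e. the real line or the complex plane).  The centred Gaussian measure
  N(0, s^2) on 'a with covariance s^2 times the identity (identifying the
  complex numbers with R^2), as a density with respect to Lebesgue measure.\<close>
definition gaussian_K :: "real \<Rightarrow> ('a::{real_normed_field, euclidean_space}) measure" where
  "gaussian_K s = density lborel
     (\<lambda>x. ennreal ((2 * pi * s\<^sup>2) powr (- real DIM('a) / 2) * exp (- (norm x)\<^sup>2 / (2 * s\<^sup>2))))"

definition gaussian_product :: "(nat \<Rightarrow> real) \<Rightarrow> (nat \<Rightarrow> 'a::{real_normed_field, euclidean_space}) measure" where
  "gaussian_product sd = (\<Pi>\<^sub>M n\<in>UNIV. gaussian_K (sd n))"

definition wbshift :: "(nat \<Rightarrow> 'a::real_normed_field) \<Rightarrow> (nat \<Rightarrow> 'a) \<Rightarrow> (nat \<Rightarrow> 'a)" where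
  "wbshift w t = (\<lambda>j. w (Suc j) * t (Suc j))"

definition shift_invariant :: "('b \<Rightarrow> 'b) \<Rightarrow> 'b measure \<Rightarrow> bool" where
  "shift_invariant T M \<longleftrightarrow> T \<in> M \<rightarrow>\<^sub>M M \<and>
     (\<forall>A\<in>sets M. emeasure M (T -` A \<inter> space M) = emeasure M A)"

definition measures_equivalent :: "'b measure \<Rightarrow> 'b measure \<Rightarrow> bool" where
  "measures_equivalent M N \<longleftrightarrow> absolutely_continuous M N \<and> absolutely_continuous N M"

definition mutually_singular :: "'b measure \<Rightarrow> 'b measure \<Rightarrow> bool" where
  "mutually_singular M N \<longleftrightarrow>
     (\<exists>A\<in>sets M. emeasure M A = 0 \<and> emeasure N (space N - A) = 0)"

end

theory Submission
  imports Defs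
begin

text \<open>Testing invariance against exp (-|x|^2/2) in one coordinate gives
  su 0 = |u 1 ... u n| su n, so the series is that of (1 - r n)^2 with r n = sv n / su n.
  The dichotomy is Kakutani's, for the likelihood ratios f N of the first N coordinates.
  If the series diverges, the Hellinger integrals of sqrt (f N) tend to 0 and the sets
  where f N < 1 separate the two measures by Borel--Cantelli.  If it converges, the f N are
  bounded in L^a for some a > 1, hence uniformly integrable: a set of small measure
  depending on finitely many coordinates has small measure for the other product, and
  this passes to all measurable sets by approximation.\<close>

text \<open>The moment criterion is one-sided: equivalence follows by exchanging the two products,
  because \<open>1 - 1 / r n\<close> is square summable along with \<open>1 - r n\<close>. The order
  \<open>a\<close> cannot be a fixed number such as 2: the moment of order \<open>a\<close> of one
  coordinate is finite only if \<open>(a - 1) * (r n)\<^sup>2 < a\<close>, and finitely many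
  \<open>r n\<close> may be arbitrarily large. A convergent series makes \<open>r\<close> converge,
  hence bounded, and \<open>a\<close> is taken close to 1 according to the bound, so that no
  coordinate needs separate treatment. Squares enter because, with
  \<open>z n = (1 / r n)\<^sup>2 - 1\<close>, the logarithm of such a moment is a positive multiple
  of \<open>a * ln (1 + z n) - ln (1 + a * z n)\<close>, whose linear terms cancel. Only the
  likelihood ratios of finitely many coordinates occur; no limit of \<open>f N\<close> is ever
  formed.\<close>

section \<open>Approximation by an algebra; criteria for absolute continuity and singularity\<close>

text \<open>The sets that can be approximated for both measures at once form a sigma-algebra
  containing \<open>C\<close>. A common \<open>B\<close> matters, since an estimate between
  \<open>P B\<close> and \<open>Q B\<close> is later transferred to \<open>A\<close>.\<close>

lemma algebra_approximation:
  fixes P Q :: "'b measure"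
  assumes P: "finite_measure P" and Q: "finite_measure Q" and sets_Q: "sets Q = sets P"
    and C: "algebra (space P) C" and sets_P: "sets P = sigma_sets (space P) C"
    and A: "A \<in> sets P" and e: "e > 0"
  shows "\<exists>B\<in>C. measure P (sym_diff A B) < e \<and> measure Q (sym_diff A B) < e"
proof -
  interpret P: finite_measure P by fact
  interpret Q: finite_measure Q by fact
  interpret C: algebra "space P" C by fact
  have C_sets: "B \<in> sets P" if "B \<in> C" for B
    using that sets_P by auto
  have "A \<in> sigma_sets (space P) C"
    using A sets_P by simp
  then show ?thesis using e
  proof (induction arbitrary: e rule: sigma_sets.induct)
    case (Basic B)
    then show ?case by (intro bexI[of _ B]) auto
  next
    case Empty
    then show ?case by (intro bexI[of _ "{}"]) auto
  next
    case (Compl A)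
    from Compl.IH[OF Compl.prems] obtain B where
      B: "B \<in> C" "measure P (sym_diff A B) < e" "measure Q (sym_diff A B) < e" by blast
    have "A \<subseteq> space P" "B \<subseteq> space P"
      using Compl.hyps B(1) sets_P sets.sets_into_space by blast+
    then have "sym_diff (space P - A) (space P - B) = sym_diff A B" by blast
    with B show ?case by (intro bexI[of _ "space P - B"]) auto
  next
    case (Union a)
    have a: "a i \<in> sets P" for i
      using Union.hyps sets_P by simp
    \<comment> \<open>What the finite unions miss decreases to the empty set. The claim is made for
      a generic \<open>M\<close> so that it serves both \<open>P\<close> and
      \<open>Q\<close>.\<close>
    have lim: "(\<lambda>n. measure M ((\<Union>i. a i) - (\<Union>i<n. a i))) \<longlonglongrightarrow> 0"
      if M: "finite_measure M" and sets_M: "sets M = sets P" for M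
    proof -
      interpret M: finite_measure M by fact
      have "(\<lambda>n. measure M ((\<Union>i. a i) - (\<Union>i<n. a i))) \<longlonglongrightarrow>
          measure M (\<Inter>n. (\<Union>i. a i) - (\<Union>i<n. a i))"
      proof (rule M.finite_Lim_measure_decseq)
        show "range (\<lambda>n. (\<Union>i. a i) - (\<Union>i<n. a i)) \<subseteq> sets M"
          using a sets_M by auto
        show "decseq (\<lambda>n. (\<Union>i. a i) - (\<Union>i<n. a i))"
          by (rule antimonoI) (force dest: less_le_trans)
      qed
      moreover have "(\<Inter>n. (\<Union>i. a i) - (\<Union>i<n. a i)) = {}"
        by (auto intro: lessI)
      ultimately show ?thesis by (simp only: measure_empty)
    qed
    have "eventually (\<lambda>n. measure P ((\<Union>i. a i) - (\<Union>i<n. a i)) < e / 2) sequentially"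
      "eventually (\<lambda>n. measure Q ((\<Union>i. a i) - (\<Union>i<n. a i)) < e / 2) sequentially"
      using order_tendstoD(2)[OF lim, of _ "e / 2"] Union.prems P Q sets_Q by simp_all
    then have "eventually (\<lambda>n. measure P ((\<Union>i. a i) - (\<Union>i<n. a i)) < e / 2 \<and>
        measure Q ((\<Union>i. a i) - (\<Union>i<n. a i)) < e / 2) sequentially"
      by (rule eventually_conj)
    then obtain n where n: "measure P ((\<Union>i. a i) - (\<Union>i<n. a i)) < e / 2"
      "measure Q ((\<Union>i. a i) - (\<Union>i<n. a i)) < e / 2"
      by (auto simp: eventually_sequentially)
    \<comment> \<open>Half of \<open>e\<close> pays for the tail, the other half is shared by
      \<open>n\<close> sets; the \<open>+ 1\<close> keeps the denominator positive when
      \<open>n = 0\<close>.\<close>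
    have "e / (2 * (real n + 1)) > 0" using Union.prems by simp
    from Union.IH[OF this] obtain b where b: "\<And>i. b i \<in> C"
      "\<And>i. measure P (sym_diff (a i) (b i)) < e / (2 * (real n + 1))"
      "\<And>i. measure Q (sym_diff (a i) (b i)) < e / (2 * (real n + 1))" by metis
    have bP: "b i \<in> sets P" for i using b(1) C_sets by simp
    have bound: "measure M (sym_diff (\<Union>i. a i) (\<Union>i<n. b i)) < e"
      if M: "finite_measure M" and sets_M: "sets M = sets P"
        and n: "measure M ((\<Union>i. a i) - (\<Union>i<n. a i)) < e / 2"
        and b: "\<And>i. measure M (sym_diff (a i) (b i)) < e / (2 * (real n + 1))" for M
    proof -
      interpret M: finite_measure M by fact
      have aM: "a i \<in> sets M" and bM: "b i \<in> sets M" for i using a bP sets_M by auto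
      have "measure M (sym_diff (\<Union>i. a i) (\<Union>i<n. b i)) \<le>
          measure M (((\<Union>i. a i) - (\<Union>i<n. a i)) \<union> (\<Union>i<n. sym_diff (a i) (b i)))"
        using aM bM by (intro M.finite_measure_mono) auto
      also have "\<dots> \<le> measure M ((\<Union>i. a i) - (\<Union>i<n. a i)) +
          measure M (\<Union>i<n. sym_diff (a i) (b i))"
        using aM bM by (intro measure_Un_le) auto
      also have "measure M (\<Union>i<n. sym_diff (a i) (b i)) \<le>
          (\<Sum>i<n. measure M (sym_diff (a i) (b i)))"
        using aM bM by (intro M.finite_measure_subadditive_finite) auto
      also have "\<dots> \<le> (\<Sum>i<n. e / (2 * (real n + 1)))"
        using b by (intro sum_mono less_imp_le)
      also have "\<dots> \<le> e / 2" using Union.prems by (simp add: field_simps)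
      finally show ?thesis using n by simp
    qed
    have "(\<Union>i<n. b i) \<in> C" using b(1) by auto
    with bound[OF P refl n(1) b(2)] bound[OF Q sets_Q n(2) b(3)] show ?case by blast
  qed
qed

text \<open>The part of \<open>f N\<close> above a level \<open>c\<close> has integral at most
  \<open>K * c powr (1 - a)\<close>, whatever \<open>N\<close> is. Hence on the whole algebra
  \<open>Q\<close> is bounded by \<open>c * P\<close> plus a term that is small for large
  \<open>c\<close>, and this survives the passage to a \<open>P\<close>-null set by
  approximation.\<close>

lemma absolutely_continuous_if_bounded_moment:
  fixes P Q :: "'b measure" and f :: "nat \<Rightarrow> 'b \<Rightarrow> real" and C :: "nat \<Rightarrow> 'b set set"
  assumes P: "prob_space P" and Q: "prob_space Q" and sets_Q: "sets Q = sets P"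
    and C: "algebra (space P) (\<Union>N. C N)" and sets_P: "sets P = sigma_sets (space P) (\<Union>N. C N)"
    and f[measurable]: "\<And>N. f N \<in> borel_measurable P" and f_nonneg: "\<And>N x. f N x \<ge> 0"
    and f_density: "\<And>N A. A \<in> C N \<Longrightarrow> emeasure Q A = (\<integral>\<^sup>+x\<in>A. ennreal (f N x) \<partial>P)"
    and a: "a > 1" and moment: "\<And>N. (\<integral>\<^sup>+x. ennreal (f N x powr a) \<partial>P) \<le> ennreal K"
  shows "absolutely_continuous P Q"
proof -
  interpret P: prob_space P by fact
  interpret Q: prob_space Q by fact
  define K' where "K' = max K 0"
  have K': "K' \<ge> 0" "ennreal K \<le> ennreal K'" by (auto simp: K'_def intro!: ennreal_leI)
  \<comment> \<open>Above \<open>c\<close>, the factor \<open>y powr (1 - a)\<close> is at most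
    \<open>c powr (1 - a)\<close> because \<open>1 - a < 0\<close>.\<close>
  have split: "y \<le> c + y powr a * c powr (1 - a)" if "y \<ge> 0" "c > 0" for y c :: real
  proof (cases "y \<le> c")
    case False
    then have "y = y powr a * y powr (1 - a)" using that by (simp flip: powr_add)
    also have "\<dots> \<le> y powr a * c powr (1 - a)"
      using False that a by (intro mult_left_mono powr_mono2') auto
    finally show ?thesis using that by simp
  qed (use that in \<open>simp add: add_increasing2\<close>)
  have cyl: "measure Q A \<le> c * measure P A + K' * c powr (1 - a)"
    if AC: "A \<in> (\<Union>N. C N)" and c: "c > 0" for A c
  proof -
    from AC obtain N where N: "A \<in> C N" by blast
    have [measurable]: "A \<in> sets P" using AC sets_P by auto
    have "emeasure Q A = (\<integral>\<^sup>+x\<in>A. ennreal (f N x) \<partial>P)" by (rule f_density) fact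
    also have "\<dots> \<le> (\<integral>\<^sup>+x. ennreal c * indicator A x + ennreal (f N x powr a) * ennreal (c powr (1 - a)) \<partial>P)"
    proof (rule nn_integral_mono)
      fix x
      have "ennreal (f N x) \<le> ennreal (c + f N x powr a * c powr (1 - a))"
        using split[OF f_nonneg c] by (rule ennreal_leI)
      then show "ennreal (f N x) * indicator A x \<le>
          ennreal c * indicator A x + ennreal (f N x powr a) * ennreal (c powr (1 - a))"
        using c by (auto simp: indicator_def ennreal_mult)
    qed
    also have "\<dots> = ennreal c * emeasure P A + (\<integral>\<^sup>+x. ennreal (f N x powr a) \<partial>P) * ennreal (c powr (1 - a))"
      by (simp add: nn_integral_add nn_integral_cmult nn_integral_multc)
    also have "\<dots> \<le> ennreal c * emeasure P A + ennreal K' * ennreal (c powr (1 - a))"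
      using moment[of N] K'(2) by (intro add_left_mono mult_right_mono) auto
    also have "\<dots> = ennreal (c * measure P A + K' * c powr (1 - a))"
      using c K'(1) by (simp add: P.emeasure_eq_measure ennreal_mult)
    finally show ?thesis
      using c K'(1) by (simp add: Q.emeasure_eq_measure del: ennreal_plus)
  qed
  have "measure Q A = 0" if A: "A \<in> null_sets P" for A
  proof (rule ccontr)
    have AP[measurable]: "A \<in> sets P" and PA: "measure P A = 0"
      using A by (auto simp: measure_eq_0_null_sets)
    have AQ[measurable]: "A \<in> sets Q" using AP sets_Q by simp
    assume "measure Q A \<noteq> 0"
    then have e: "measure Q A > 0" (is "?e > 0") by (simp add: zero_less_measure_iff)
    have "((\<lambda>c. K' * c powr (1 - a)) \<longlongrightarrow> K' * 0) at_top"
      using a by (intro tendsto_intros tendsto_neg_powr filterlim_ident) auto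
    then have "eventually (\<lambda>c. K' * c powr (1 - a) < ?e / 2) at_top"
      using e by (intro order_tendstoD(2)) auto
    then have "eventually (\<lambda>c. K' * c powr (1 - a) < ?e / 2 \<and> c > 0) at_top"
      by (intro eventually_conj eventually_gt_at_top)
    then obtain c where c: "K' * c powr (1 - a) < ?e / 2" "c > 0"
      by (auto simp: eventually_at_top_linorder)
    \<comment> \<open>The level \<open>c\<close> is fixed before \<open>B\<close> is chosen. For
      this tolerance, \<open>c\<close> times it plus once more itself is exactly
      \<open>?e / 2\<close>, the other half being kept for the moment term.\<close>
    have "?e / (2 * (c + 1)) > 0" using e c by simp
    from algebra_approximation[OF P.finite_measure_axioms Q.finite_measure_axioms sets_Q C sets_P AP this]
    obtain B where B: "B \<in> (\<Union>N. C N)" "measure P (sym_diff A B) < ?e / (2 * (c + 1))"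
      "measure Q (sym_diff A B) < ?e / (2 * (c + 1))" by blast
    have BP[measurable]: "B \<in> sets P" using B(1) sets_P by auto
    have BQ[measurable]: "B \<in> sets Q" using BP sets_Q by simp
    have half: "c * (?e / (2 * (c + 1))) + ?e / (2 * (c + 1)) = ?e / 2"
      using c(2) by (simp add: divide_simps) (simp add: algebra_simps)
    have "measure P B \<le> measure P (A \<union> sym_diff A B)"
      by (intro P.finite_measure_mono) auto
    also have "\<dots> \<le> measure P A + measure P (sym_diff A B)"
      by (intro measure_Un_le) auto
    finally have PB: "measure P B \<le> ?e / (2 * (c + 1))" using B(2) PA by simp
    have "?e \<le> measure Q (B \<union> sym_diff A B)"
      by (intro Q.finite_measure_mono) auto
    also have "\<dots> \<le> measure Q B + measure Q (sym_diff A B)"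
      by (intro measure_Un_le) auto
    also have "\<dots> < c * measure P B + K' * c powr (1 - a) + ?e / (2 * (c + 1))"
      using cyl[OF B(1) c(2)] B(3) by simp
    also have "\<dots> \<le> c * (?e / (2 * (c + 1))) + ?e / (2 * (c + 1)) + K' * c powr (1 - a)"
      using mult_left_mono[OF PB, of c] c(2) by simp
    also have "\<dots> = ?e / 2 + K' * c powr (1 - a)" by (simp only: half)
    also have "\<dots> < ?e" using c(1) by simp
    finally show False .
  qed
  then have "A \<in> null_sets Q" if "A \<in> null_sets P" for A
    using that by (intro null_setsI) (auto simp: Q.emeasure_eq_measure sets_Q dest: null_setsD2)
  then show ?thesis unfolding absolutely_continuous_def by (rule subsetI)
qed

text \<open>One integral controls both errors: \<open>1 \<le> sqrt (f N)\<close> where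
  \<open>f N \<ge> 1\<close>, and \<open>f N \<le> sqrt (f N)\<close> where \<open>f N < 1\<close>,
  so it bounds the \<open>P\<close>-measure of the first set and the \<open>Q\<close>-measure of the
  second. Indices \<open>N k\<close> with bounds \<open>(1/2) ^ k\<close> make both sequences of
  measures summable.\<close>

lemma mutually_singular_if_hellinger_vanishes:
  fixes P Q :: "'b measure" and f :: "nat \<Rightarrow> 'b \<Rightarrow> real"
  assumes P: "prob_space P" and Q: "prob_space Q" and sets_Q: "sets Q = sets P"
    and f[measurable]: "\<And>N. f N \<in> borel_measurable P" and f_nonneg: "\<And>N x. f N x \<ge> 0"
    and f_density: "\<And>N. emeasure Q {x \<in> space P. f N x < 1} =
      (\<integral>\<^sup>+x\<in>{x \<in> space P. f N x < 1}. ennreal (f N x) \<partial>P)"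
    and hellinger: "\<And>e. e > 0 \<Longrightarrow> \<exists>N. (\<integral>\<^sup>+x. ennreal (f N x powr (1/2)) \<partial>P) \<le> ennreal e"
  shows "mutually_singular P Q"
proof -
  interpret P: prob_space P by fact
  interpret Q: prob_space Q by fact
  have space_Q: "space Q = space P" using sets_Q by (rule sets_eq_imp_space_eq)
  have "\<exists>N. (\<integral>\<^sup>+x. ennreal (f N x powr (1/2)) \<partial>P) \<le> ennreal ((1/2) ^ k)" for k
    by (rule hellinger) simp
  then obtain N where N: "\<And>k. (\<integral>\<^sup>+x. ennreal (f (N k) x powr (1/2)) \<partial>P) \<le> ennreal ((1/2) ^ k)"
    by metis
  define L where "L k = {x \<in> space P. f (N k) x < 1}" for k
  define G where "G k = {x \<in> space P. f (N k) x \<ge> 1}" for k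
  have L[measurable]: "L k \<in> sets P" and G[measurable]: "G k \<in> sets P" for k
    unfolding L_def G_def by measurable
  have LQ: "L k \<in> sets Q" for k using L sets_Q by simp
  have GL: "x \<in> G k \<longleftrightarrow> x \<notin> L k" if "x \<in> space P" for x k
    using that by (auto simp: L_def G_def)
  have "emeasure P (G k) \<le> ennreal ((1/2) ^ k)" for k
  proof -
    have "emeasure P (G k) = (\<integral>\<^sup>+x. indicator (G k) x \<partial>P)" by simp
    also have "\<dots> \<le> (\<integral>\<^sup>+x. ennreal (f (N k) x powr (1/2)) \<partial>P)"
      by (intro nn_integral_mono) (auto simp: indicator_def G_def intro!: ge_one_powr_ge_zero)
    finally show ?thesis using N[of k] by simp
  qed
  then have PG: "measure P (G k) \<le> (1/2) ^ k" for k
    by (simp add: P.emeasure_eq_measure)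
  have "emeasure Q (L k) \<le> ennreal ((1/2) ^ k)" for k
  proof -
    have "emeasure Q (L k) = (\<integral>\<^sup>+x\<in>L k. ennreal (f (N k) x) \<partial>P)"
      unfolding L_def by (rule f_density)
    also have "\<dots> \<le> (\<integral>\<^sup>+x. ennreal (f (N k) x powr (1/2)) \<partial>P)"
    proof (intro nn_integral_mono)
      fix x
      have "f (N k) x \<le> f (N k) x powr (1/2)" if "f (N k) x < 1"
        using powr_mono'[of "1/2" 1 "f (N k) x"] that f_nonneg[of "N k" x] by simp
      then show "ennreal (f (N k) x) * indicator (L k) x \<le> ennreal (f (N k) x powr (1/2))"
        by (auto simp: indicator_def L_def intro!: ennreal_leI)
    qed
    finally show ?thesis using N[of k] by simp
  qed
  then have QL: "measure Q (L k) \<le> (1/2) ^ k" for k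
    by (simp add: Q.emeasure_eq_measure)
  have geom: "summable (\<lambda>k. (1/2 :: real) ^ k)" by (simp add: summable_geometric)
  have "AE x in P. eventually (\<lambda>k. x \<in> space P - G k) sequentially"
    using PG by (intro borel_cantelli_AE1 summable_comparison_test'[OF geom, of 0])
      (auto simp: P.emeasure_eq_measure)
  then have AE_P: "AE x in P. eventually (\<lambda>k. x \<in> L k) sequentially"
    by eventually_elim (auto elim: eventually_mono simp: GL)
  have "AE x in Q. eventually (\<lambda>k. x \<in> space Q - L k) sequentially"
    using QL LQ by (intro borel_cantelli_AE1 summable_comparison_test'[OF geom, of 0])
      (auto simp: Q.emeasure_eq_measure)
  then have AE_Q: "AE x in Q. \<not> eventually (\<lambda>k. x \<in> L k) sequentially"
  proof eventually_elim
    case (elim x)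
    show ?case
    proof
      assume "eventually (\<lambda>k. x \<in> L k) sequentially"
      with elim have "eventually (\<lambda>k. False) sequentially"
        by eventually_elim simp
      then show False by simp
    qed
  qed
  define A where "A = {x \<in> space P. \<not> eventually (\<lambda>k. x \<in> L k) sequentially}"
  have [measurable]: "A \<in> sets P" unfolding A_def by measurable
  have "emeasure P A = 0"
    using AE_P by (subst (asm) AE_iff_measurable[where N = A]) (auto simp: A_def)
  moreover have "emeasure Q (space Q - A) = 0"
    using AE_Q by (subst (asm) AE_iff_measurable[where N = "space Q - A"])
      (auto simp: A_def space_Q sets_Q)
  ultimately show ?thesis unfolding mutually_singular_def by (intro bexI[of _ A]) auto
qed

text \<open>A \<open>P\<close>-null set carrying all of \<open>Q\<close> would also be
  \<open>Q\<close>-null, against total mass 1. This makes the two alternatives of the dichotomy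
  exclusive.\<close>

lemma mutually_singular_not_absolutely_continuous:
  assumes "prob_space Q" and sets_Q: "sets Q = sets P"
    and ac: "absolutely_continuous P Q" and "mutually_singular P Q"
  shows False
proof -
  interpret Q: prob_space Q by fact
  obtain A where A: "A \<in> sets P" "emeasure P A = 0" "emeasure Q (space Q - A) = 0"
    using assms(4) unfolding mutually_singular_def by auto
  have "A \<in> null_sets Q" using ac A by (auto simp: absolutely_continuous_def null_sets_def)
  then have "measure Q A = 0" by (auto simp: measure_eq_0_null_sets)
  moreover have "measure Q (space Q - A) = 0" using A by (simp add: measure_def)
  ultimately show False using Q.prob_compl[of A] A sets_Q by simp
qed

section \<open>Densities of product measures and cylinder sets\<close>

text \<open>A finite product measure is determined by its values on boxes, and over a box the
  integral of the product density splits into factors.\<close>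

lemma PiM_density:
  fixes M :: "'i \<Rightarrow> 'b measure" and l :: "'i \<Rightarrow> 'b \<Rightarrow> ennreal"
  assumes I: "finite I" and M: "\<And>i. prob_space (M i)"
    and l[measurable]: "\<And>i. l i \<in> borel_measurable (M i)"
    and Ml: "\<And>i. prob_space (density (M i) (l i))"
  shows "PiM I (\<lambda>i. density (M i) (l i)) = density (PiM I M) (\<lambda>x. \<Prod>i\<in>I. l i (x i))"
proof -
  interpret M: product_prob_space M I by (rule product_prob_spaceI) (rule M)
  interpret Ml: product_prob_space "\<lambda>i. density (M i) (l i)" I
    by (rule product_prob_spaceI) (rule Ml)
  have comp: "(\<lambda>x. l i (x i)) \<in> borel_measurable (PiM K M)" if "i \<in> K" for i K
    by (rule measurable_compose[OF measurable_component_singleton[OF that] l])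
  have [measurable]: "(\<lambda>x. \<Prod>i\<in>I. l i (x i)) \<in> borel_measurable (PiM I M)"
    by (intro borel_measurable_prod_ennreal comp)
  show ?thesis
  proof (rule sym, rule Ml.PiM_eqI)
    show "sets (density (PiM I M) (\<lambda>x. \<Prod>i\<in>I. l i (x i))) = sets (PiM I (\<lambda>i. density (M i) (l i)))"
      by (simp cong: sets_PiM_cong)
    fix A assume A: "\<And>i. i \<in> I \<Longrightarrow> A i \<in> sets (density (M i) (l i))"
    then have [measurable]: "PiE I A \<in> sets (PiM I M)"
      using I by (intro sets_PiM_I_finite) auto
    have "emeasure (density (PiM I M) (\<lambda>x. \<Prod>i\<in>I. l i (x i))) (PiE I A) =
        (\<integral>\<^sup>+x. (\<Prod>i\<in>I. l i (x i)) * indicator (PiE I A) x \<partial>PiM I M)"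
      by (simp add: emeasure_density)
    also have "\<dots> = (\<integral>\<^sup>+x. (\<Prod>i\<in>I. l i (x i) * indicator (A i) (x i)) \<partial>PiM I M)"
    proof (rule nn_integral_cong)
      fix x assume "x \<in> space (PiM I M)"
      \<comment> \<open>The indicator of \<open>PiE I A\<close> factors only because
        \<open>x\<close> is \<open>undefined\<close> outside \<open>I\<close>; for other functions
        the left side is 0 whatever the factors are.\<close>
      then have "x \<in> extensional I" by (auto simp: space_PiM PiE_def)
      then have "indicator (PiE I A) x = (\<Prod>i\<in>I. indicator (A i) (x i) :: ennreal)"
        using I by (auto simp: indicator_def PiE_def Pi_def prod_zero_iff)
      then show "(\<Prod>i\<in>I. l i (x i)) * indicator (PiE I A) x =
          (\<Prod>i\<in>I. l i (x i) * indicator (A i) (x i))"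
        by (simp add: prod.distrib)
    qed
    also have "\<dots> = (\<Prod>i\<in>I. \<integral>\<^sup>+x. l i x * indicator (A i) x \<partial>M i)"
      using A I by (intro M.product_nn_integral_prod) auto
    also have "\<dots> = (\<Prod>i\<in>I. emeasure (density (M i) (l i)) (A i))"
      using A by (intro prod.cong) (auto simp: emeasure_density)
    finally show "emeasure (density (PiM I M) (\<lambda>x. \<Prod>i\<in>I. l i (x i))) (PiE I A) =
        (\<Prod>i\<in>I. emeasure (density (M i) (l i)) (A i))" .
  qed (rule I)
qed

text \<open>\<open>I\<close> may be infinite: the integrand sees only the coordinates in
  \<open>J\<close>, so restriction to \<open>J\<close> carries the integral to a finite
  product.\<close>

lemma nn_integral_PiM_prod:
  fixes M :: "'i \<Rightarrow> 'b measure" and g :: "'i \<Rightarrow> 'b \<Rightarrow> ennreal"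
  assumes J: "finite J" "J \<subseteq> I" and M: "\<And>i. prob_space (M i)"
    and g: "\<And>i. g i \<in> borel_measurable (M i)"
  shows "(\<integral>\<^sup>+x. (\<Prod>i\<in>J. g i (x i)) \<partial>PiM I M) = (\<Prod>i\<in>J. \<integral>\<^sup>+x. g i x \<partial>M i)"
proof -
  interpret M: product_prob_space M I by (rule product_prob_spaceI) (rule M)
  have comp: "(\<lambda>x. g i (x i)) \<in> borel_measurable (PiM K M)" if "i \<in> K" for i K
    by (rule measurable_compose[OF measurable_component_singleton[OF that] g])
  have "(\<Prod>i\<in>J. \<integral>\<^sup>+x. g i x \<partial>M i) = (\<integral>\<^sup>+x. (\<Prod>i\<in>J. g i (x i)) \<partial>PiM J M)"
    using J(1) g by (intro M.product_nn_integral_prod[symmetric])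
  also have "\<dots> = (\<integral>\<^sup>+x. (\<Prod>i\<in>J. g i (restrict x J i)) \<partial>PiM I M)"
    using J g by (subst M.distr_PiM_restrict_finite[OF J, symmetric],
        intro nn_integral_distr measurable_restrict_subset borel_measurable_prod_ennreal)
      (simp_all add: comp)
  also have "\<dots> = (\<integral>\<^sup>+x. (\<Prod>i\<in>J. g i (x i)) \<partial>PiM I M)"
    by (intro nn_integral_cong prod.cong) auto
  finally show ?thesis by simp
qed

text \<open>\<open>M n\<close> and \<open>density (M n) (l n)\<close> are the laws of coordinate
  \<open>n\<close> under \<open>P\<close> and \<open>Q\<close>. Full coordinate spaces make every
  function a point of \<open>P\<close>, in particular the truncation
  \<open>restrict t {..<N}\<close> with its value \<open>undefined\<close> from \<open>N\<close>
  on.\<close>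

locale product_density =
  fixes M :: "nat \<Rightarrow> 'b measure" and l :: "nat \<Rightarrow> 'b \<Rightarrow> real"
  assumes prob_M: "\<And>n. prob_space (M n)" and space_M: "\<And>n. space (M n) = UNIV"
    and l_measurable[measurable]: "\<And>n. l n \<in> borel_measurable (M n)"
    and l_nonneg: "\<And>n x. l n x \<ge> 0"
    and prob_density: "\<And>n. prob_space (density (M n) (l n))"
begin

abbreviation "P \<equiv> PiM UNIV M"
abbreviation "Q \<equiv> PiM UNIV (\<lambda>n. density (M n) (l n))"

definition f :: "nat \<Rightarrow> (nat \<Rightarrow> 'b) \<Rightarrow> real" where
  "f N t = (\<Prod>n<N. l n (t n))"

text \<open>Invariance under truncation says that membership depends on the coordinates below
  \<open>N\<close> only. Stating it inside the infinite product, not through preimages from finite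
  ones, puts all \<open>Cyl N\<close> into one space, where they increase with
  \<open>N\<close>.\<close>

definition Cyl :: "nat \<Rightarrow> (nat \<Rightarrow> 'b) set set" where
  "Cyl N = {A \<in> sets P. (\<lambda>t. restrict t {..<N}) -` A = A}"

lemma prob_P: "prob_space P" and prob_Q: "prob_space Q"
  using prob_M prob_density by (auto intro!: prob_space_PiM)

lemma sets_Q: "sets Q = sets P"
  by (simp cong: sets_PiM_cong)

lemma space_P: "space P = UNIV"
  by (simp add: space_PiM space_M)

lemma l_component_measurable:
  assumes "n \<in> K" shows "(\<lambda>t. l n (t n)) \<in> borel_measurable (PiM K M)"
  by (rule measurable_compose[OF measurable_component_singleton[OF assms] l_measurable])

lemma f_measurable[measurable]: "f N \<in> borel_measurable P"
  unfolding f_def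
  by (intro borel_measurable_prod l_component_measurable) simp

lemma f_nonneg: "f N t \<ge> 0"
  unfolding f_def by (intro prod_nonneg) (simp add: l_nonneg)

lemma Cyl_iff: "A \<in> Cyl N \<longleftrightarrow> A \<in> sets P \<and> (\<forall>t. restrict t {..<N} \<in> A \<longleftrightarrow> t \<in> A)"
  by (auto simp: Cyl_def)

lemma Cyl_mono:
  assumes "N \<le> N'" shows "Cyl N \<subseteq> Cyl N'"
proof
  fix A assume A: "A \<in> Cyl N"
  have "restrict (restrict t {..<N'}) {..<N} = restrict t {..<N}" for t :: "nat \<Rightarrow> 'b"
    using assms by (auto simp: fun_eq_iff)
  with A show "A \<in> Cyl N'" by (metis Cyl_iff)
qed

lemma algebra_Cyl: "algebra (space P) (\<Union>N. Cyl N)"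
  unfolding algebra_iff_Un
proof (intro conjI ballI)
  show "(\<Union>N. Cyl N) \<subseteq> Pow (space P)" by (simp add: space_P)
  show "{} \<in> (\<Union>N. Cyl N)" by (auto simp: Cyl_iff)
  show "space P - A \<in> (\<Union>N. Cyl N)" if "A \<in> (\<Union>N. Cyl N)" for A
    using that by (auto simp: Cyl_iff space_P simp flip: Compl_eq_Diff_UNIV
        intro: sets.compl_sets[where M = P, unfolded space_P, folded Compl_eq_Diff_UNIV])
  fix A B assume "A \<in> (\<Union>N. Cyl N)" "B \<in> (\<Union>N. Cyl N)"
  then obtain N N' where "A \<in> Cyl N" "B \<in> Cyl N'" by blast
  then have "A \<in> Cyl (max N N')" "B \<in> Cyl (max N N')"
    using Cyl_mono[of N "max N N'"] Cyl_mono[of N' "max N N'"] by auto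
  then have "A \<union> B \<in> Cyl (max N N')" by (auto simp: Cyl_iff)
  then show "A \<union> B \<in> (\<Union>N. Cyl N)" by blast
qed

lemma sets_P: "sets P = sigma_sets (space P) (\<Union>N. Cyl N)"
proof
  have "{x \<in> space P. x i \<in> A} \<in> (\<Union>N. Cyl N)" if "A \<in> sets (M i)" for i A
  proof -
    have "{x \<in> space P. x i \<in> A} \<in> sets P" using that by measurable
    \<comment> \<open>Truncation at \<open>N\<close> keeps coordinate \<open>i\<close> exactly when
      \<open>i < N\<close>, hence \<open>Suc i\<close>.\<close>
    then have "{x \<in> space P. x i \<in> A} \<in> Cyl (Suc i)" by (simp add: Cyl_iff space_P)
    then show ?thesis by blast
  qed
  then show "sets P \<subseteq> sigma_sets (space P) (\<Union>N. Cyl N)"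
    unfolding sets_PiM_single space_PiM[symmetric] by (intro sigma_sets_mono') auto
  show "sigma_sets (space P) (\<Union>N. Cyl N) \<subseteq> sets P"
    by (intro sets.sigma_sets_subset) (auto simp: Cyl_iff)
qed

text \<open>Restriction carries \<open>P\<close> and \<open>Q\<close> to finite products over
  \<open>{..<N}\<close>, where densities multiply. The base of the cylinder there is
  \<open>A \<inter> space ?MI\<close>, the points of \<open>A\<close> that are
  \<open>undefined\<close> from \<open>N\<close> on.\<close>

lemma emeasure_Q_Cyl:
  assumes A: "A \<in> Cyl N"
  shows "emeasure Q A = (\<integral>\<^sup>+t\<in>A. ennreal (f N t) \<partial>P)"
proof -
  interpret M: product_prob_space M UNIV by (rule product_prob_spaceI) (rule prob_M)
  interpret Ml: product_prob_space "\<lambda>n. density (M n) (l n)" UNIV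
    by (rule product_prob_spaceI) (rule prob_density)
  let ?I = "{..<N}" and ?MI = "PiM {..<N} M" and ?QI = "PiM {..<N} (\<lambda>n. density (M n) (l n))"
  have sets_QI: "sets ?QI = sets ?MI" by (simp cong: sets_PiM_cong)
  have [measurable]: "A \<in> sets P" using A by (simp add: Cyl_iff)
  have A_iff: "restrict t ?I \<in> A \<longleftrightarrow> t \<in> A" for t using A by (simp add: Cyl_iff)
  have restrict_in: "restrict t ?I \<in> space ?MI" for t
    by (auto simp: space_PiM space_M)
  \<comment> \<open>The finite product lies inside the infinite one, and its points have the
    constant coordinate \<open>undefined\<close> from \<open>N\<close> on. Measurability of this
    inclusion makes the base of \<open>A\<close> measurable.\<close>
  have "(\<lambda>x. x) \<in> measurable ?MI P"
  proof (rule measurable_PiM_single')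
    fix i :: nat
    show "(\<lambda>x. x i) \<in> measurable ?MI (M i)"
    proof (cases "i < N")
      case False
      then have "x i = undefined" if "x \<in> space ?MI" for x
        using that by (auto simp: space_PiM PiE_def extensional_def)
      then have "(\<lambda>x. x i) \<in> measurable ?MI (M i) \<longleftrightarrow> (\<lambda>x. undefined) \<in> measurable ?MI (M i)"
        by (rule measurable_cong)
      then show ?thesis by (simp add: space_M)
    qed simp
  qed (auto simp: space_M)
  then have "(\<lambda>x. x) -` A \<inter> space ?MI \<in> sets ?MI" by measurable
  then have AI[measurable]: "A \<inter> space ?MI \<in> sets ?MI" by simp
  have restr[measurable]: "(\<lambda>t. restrict t ?I) \<in> measurable P ?MI"
    by (rule measurable_restrict_subset) simp
  have restr_Q: "(\<lambda>t. restrict t ?I) \<in> measurable Q ?QI"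
    by (rule measurable_restrict_subset) simp
  have [measurable]: "(\<lambda>x. \<Prod>n<N. ennreal (l n (x n))) \<in> borel_measurable ?MI"
    by (intro borel_measurable_prod_ennreal measurable_compose[OF l_component_measurable measurable_ennreal])
  have "emeasure ?QI (A \<inter> space ?MI) = emeasure Q A"
    using restr_Q AI sets_QI restrict_in
    by (subst Ml.distr_PiM_restrict_finite[of ?I, OF finite_lessThan subset_UNIV, symmetric],
        subst emeasure_distr) (auto simp: A_iff space_PiM space_M intro!: arg_cong2[where f = emeasure])
  then have "emeasure Q A = emeasure ?QI (A \<inter> space ?MI)" by simp
  also have "?QI = density ?MI (\<lambda>x. \<Prod>n<N. ennreal (l n (x n)))"
    using prob_M prob_density by (intro PiM_density) auto
  also have "emeasure \<dots> (A \<inter> space ?MI) =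
      (\<integral>\<^sup>+x. (\<Prod>n<N. ennreal (l n (x n))) * indicator (A \<inter> space ?MI) x \<partial>?MI)"
    by (subst emeasure_density) auto
  also have "\<dots> = (\<integral>\<^sup>+t. (\<Prod>n<N. ennreal (l n (restrict t ?I n))) *
      indicator (A \<inter> space ?MI) (restrict t ?I) \<partial>P)"
    by (subst M.distr_PiM_restrict_finite[of ?I, OF finite_lessThan subset_UNIV, symmetric],
        subst nn_integral_distr) auto
  also have "\<dots> = (\<integral>\<^sup>+t\<in>A. ennreal (f N t) \<partial>P)"
    using restrict_in
    by (intro nn_integral_cong) (auto simp: f_def indicator_def A_iff prod_ennreal l_nonneg)
  finally show ?thesis .
qed

lemma nn_integral_f_powr:
  "(\<integral>\<^sup>+t. ennreal (f N t powr a) \<partial>P) = (\<Prod>n<N. \<integral>\<^sup>+x. ennreal (l n x powr a) \<partial>M n)"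
proof -
  have "(\<integral>\<^sup>+t. ennreal (f N t powr a) \<partial>P) = (\<integral>\<^sup>+t. (\<Prod>n<N. ennreal (l n (t n) powr a)) \<partial>P)"
    by (simp add: f_def prod_powr_distrib prod_ennreal)
  also have "\<dots> = (\<Prod>n<N. \<integral>\<^sup>+x. ennreal (l n x powr a) \<partial>M n)"
    by (intro nn_integral_PiM_prod prob_M) auto
  finally show ?thesis .
qed

lemma absolutely_continuous_product:
  assumes "a > 1" and "\<And>N. (\<Prod>n<N. \<integral>\<^sup>+x. ennreal (l n x powr a) \<partial>M n) \<le> ennreal K"
  shows "absolutely_continuous P Q"
proof (rule absolutely_continuous_if_bounded_moment
    [OF prob_P prob_Q sets_Q algebra_Cyl sets_P f_measurable f_nonneg])
  show "(\<integral>\<^sup>+t. ennreal (f N t powr a) \<partial>P) \<le> ennreal K" for N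
    using assms(2) by (simp add: nn_integral_f_powr)
  show "emeasure Q A = (\<integral>\<^sup>+t\<in>A. ennreal (f N t) \<partial>P)" if "A \<in> Cyl N" for N A
    using that by (rule emeasure_Q_Cyl)
qed (rule assms(1))

lemma mutually_singular_product:
  assumes "\<And>e. e > 0 \<Longrightarrow> \<exists>N. (\<Prod>n<N. \<integral>\<^sup>+x. ennreal (l n x powr (1/2)) \<partial>M n) \<le> ennreal e"
  shows "mutually_singular P Q"
proof (rule mutually_singular_if_hellinger_vanishes[OF prob_P prob_Q sets_Q f_measurable f_nonneg])
  have "{t \<in> space P. f N t < 1} \<in> Cyl N" for N
  proof -
    have "{t \<in> space P. f N t < 1} \<in> sets P" by measurable
    moreover have "f N (restrict t {..<N}) = f N t" for t by (simp add: f_def)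
    ultimately show ?thesis by (simp add: Cyl_iff space_P)
  qed
  then show "emeasure Q {t \<in> space P. f N t < 1} =
      (\<integral>\<^sup>+t\<in>{t \<in> space P. f N t < 1}. ennreal (f N t) \<partial>P)" for N
    by (rule emeasure_Q_Cyl)
qed (use assms in \<open>simp add: nn_integral_f_powr\<close>)

end

section \<open>Gaussian integrals and the density ratio of two centred Gaussians\<close>

lemma nn_integral_exp_square_real:
  fixes c :: real
  assumes "c > 0"
  shows "(\<integral>\<^sup>+x. ennreal (exp (- c * x\<^sup>2)) \<partial>lborel) = ennreal (sqrt (pi / c))"
proof -
  \<comment> \<open>The standard deviation whose normal density is proportional to
    \<open>exp (- c * x\<^sup>2)\<close>.\<close>
  define s where "s = sqrt (1 / (2 * c))"
  have s: "s > 0" "s\<^sup>2 = 1 / (2 * c)" using assms by (auto simp: s_def)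
  interpret N: prob_space "density lborel (\<lambda>x. ennreal (normal_density 0 s x))"
    using s(1) by (rule prob_space_normal_density)
  have "exp (- c * x\<^sup>2) = sqrt (pi / c) * normal_density 0 s x" for x
    using assms by (simp add: normal_density_def s(2))
  then have "(\<integral>\<^sup>+x. ennreal (exp (- c * x\<^sup>2)) \<partial>lborel) =
      (\<integral>\<^sup>+x. ennreal (sqrt (pi / c)) * ennreal (normal_density 0 s x) \<partial>lborel)"
    using assms by (intro nn_integral_cong) (simp only: ennreal_mult normal_density_nonneg real_sqrt_ge_zero pi_ge_zero divide_nonneg_pos)
  also have "\<dots> = ennreal (sqrt (pi / c)) * (\<integral>\<^sup>+x. ennreal (normal_density 0 s x) \<partial>lborel)"
    by (rule nn_integral_cmult) simp
  also have "(\<integral>\<^sup>+x. ennreal (normal_density 0 s x) \<partial>lborel) = 1"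
    using N.emeasure_space_1 by (simp add: emeasure_density)
  finally show ?thesis by simp
qed

text \<open>The exponential of a squared norm factors over an orthonormal basis, which treats real
  and complex scalars at once.\<close>

lemma nn_integral_exp_square:
  fixes c :: real
  assumes c: "c > 0"
  shows "(\<integral>\<^sup>+x. ennreal (exp (- c * (norm (x :: 'a :: euclidean_space))\<^sup>2)) \<partial>lborel) =
    ennreal ((pi / c) powr (DIM('a) / 2))"
proof -
  have "exp (- c * (norm x)\<^sup>2) = (\<Prod>b\<in>Basis. exp (- c * (x \<bullet> b)\<^sup>2))" for x :: 'a
  proof -
    have "(norm x)\<^sup>2 = (\<Sum>b\<in>Basis. (x \<bullet> b)\<^sup>2)"
      by (subst power2_norm_eq_inner, subst euclidean_inner) (simp add: power2_eq_square)
    then show ?thesis by (simp add: exp_sum sum_distrib_left flip: sum_negf)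
  qed
  then have "(\<integral>\<^sup>+x. ennreal (exp (- c * (norm (x :: 'a))\<^sup>2)) \<partial>lborel) =
      (\<integral>\<^sup>+x. (\<Prod>b\<in>Basis. ennreal (exp (- c * (x \<bullet> b)\<^sup>2))) \<partial>(lborel :: 'a measure))"
    by (simp add: prod_ennreal)
  also have "\<dots> = (\<Prod>b\<in>(Basis :: 'a set). \<integral>\<^sup>+x. ennreal (exp (- c * x\<^sup>2)) \<partial>lborel)"
    by (rule nn_integral_lborel_prod) auto
  also have "\<dots> = ennreal (sqrt (pi / c) ^ DIM('a))"
    using c by (simp add: nn_integral_exp_square_real[OF c, simplified] ennreal_power)
  also have "sqrt (pi / c) ^ DIM('a) = (pi / c) powr (DIM('a) / 2)"
    using c by (simp add: powr_half_sqrt[symmetric] powr_powr flip: powr_realpow)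
  finally show ?thesis .
qed

lemma powr_uminus_mult_powr_divide:
  fixes x y p :: real
  assumes "x > 0" "y > 0"
  shows "x powr (- p) * (x / y) powr p = y powr (- p)"
  using assms by (simp add: powr_divide powr_minus field_simps)

lemma sets_gaussian_K [measurable_cong, simp]: "sets (gaussian_K s) = sets borel"
  by (simp add: gaussian_K_def)

lemma space_gaussian_K [simp]: "space (gaussian_K s) = UNIV"
  by (simp add: gaussian_K_def)

text \<open>This integral serves three times: \<open>c = 0\<close> gives total mass 1, other values
  give the moments of the density ratio and the test of invariance. Negative \<open>c\<close> is
  allowed; the condition on \<open>c\<close> says that the combined exponent still decays.\<close>

lemma nn_integral_gaussian_K_exp:
  fixes c s :: real
  assumes s: "s > 0" and c: "1 + 2 * c * s\<^sup>2 > 0"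
  shows "(\<integral>\<^sup>+x. ennreal (exp (- c * (norm (x :: 'a :: {real_normed_field, euclidean_space}))\<^sup>2)) \<partial>gaussian_K s)
    = ennreal ((1 + 2 * c * s\<^sup>2) powr (- real DIM('a) / 2))"
proof -
  define k where "k = (1 + 2 * c * s\<^sup>2) / (2 * s\<^sup>2)"
  have k: "k > 0" using s c by (simp add: k_def)
  let ?C = "(2 * pi * s\<^sup>2) powr (- real DIM('a) / 2)"
  have "- (norm x)\<^sup>2 / (2 * s\<^sup>2) + - c * (norm x)\<^sup>2 = - k * (norm x)\<^sup>2" for x :: 'a
    using s by (simp add: k_def field_simps)
  then have exponent: "exp (- (norm x)\<^sup>2 / (2 * s\<^sup>2)) * exp (- c * (norm x)\<^sup>2) =
      exp (- k * (norm x)\<^sup>2)" for x :: 'a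
    by (simp only: flip: exp_add)
  have "(\<integral>\<^sup>+x. ennreal (exp (- c * (norm (x :: 'a))\<^sup>2)) \<partial>gaussian_K s) =
      (\<integral>\<^sup>+x. ennreal (?C * exp (- (norm x)\<^sup>2 / (2 * s\<^sup>2))) * ennreal (exp (- c * (norm x)\<^sup>2)) \<partial>(lborel :: 'a measure))"
    unfolding gaussian_K_def by (rule nn_integral_density) auto
  also have "\<dots> = (\<integral>\<^sup>+x. ennreal ?C * ennreal (exp (- k * (norm x)\<^sup>2)) \<partial>(lborel :: 'a measure))"
    by (intro nn_integral_cong) (simp add: mult.assoc exponent[simplified] flip: ennreal_mult)
  also have "\<dots> = ennreal ?C * ennreal ((pi / k) powr (DIM('a) / 2))"
    by (subst nn_integral_cmult) (simp_all add: nn_integral_exp_square[OF k, simplified])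
  also have "\<dots> = ennreal (?C * (pi / k) powr (DIM('a) / 2))"
    by (simp flip: ennreal_mult)
  also have "?C * (pi / k) powr (DIM('a) / 2) = (1 + 2 * c * s\<^sup>2) powr (- real DIM('a) / 2)"
  proof -
    have "pi / k = 2 * pi * s\<^sup>2 / (1 + 2 * c * s\<^sup>2)" by (simp add: k_def)
    moreover have "2 * pi * s\<^sup>2 > 0" using s by simp
    ultimately show ?thesis
      using powr_uminus_mult_powr_divide[OF _ c, of "2 * pi * s\<^sup>2" "real DIM('a) / 2"]
      by (simp only: minus_divide_left)
  qed
  finally show ?thesis .
qed

lemma prob_space_gaussian_K:
  assumes "s > 0"
  shows "prob_space (gaussian_K s :: 'a :: {real_normed_field, euclidean_space} measure)"
proof
  show "emeasure (gaussian_K s :: 'a measure) (space (gaussian_K s)) = 1"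
    using nn_integral_gaussian_K_exp[OF assms, of 0, where 'a = 'a] by simp
qed

text \<open>The Radon--Nikodym derivative of \<open>gaussian_K s'\<close> with respect to
  \<open>gaussian_K s\<close>.\<close>

definition gaussian_ratio :: "real \<Rightarrow> real \<Rightarrow> 'a :: {real_normed_field, euclidean_space} \<Rightarrow> real" where
  "gaussian_ratio s s' x =
    (s / s') powr DIM('a) * exp (- (1 / (2 * s'\<^sup>2) - 1 / (2 * s\<^sup>2)) * (norm x)\<^sup>2)"

lemma gaussian_ratio_measurable [measurable]: "gaussian_ratio s s' \<in> borel_measurable borel"
  unfolding gaussian_ratio_def by measurable

lemma gaussian_ratio_nonneg: "gaussian_ratio s s' x \<ge> 0"
  by (simp add: gaussian_ratio_def)

lemma gaussian_K_eq_density: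
  assumes s: "s > 0" "s' > 0"
  shows "gaussian_K s' = density (gaussian_K s :: 'a :: {real_normed_field, euclidean_space} measure)
    (\<lambda>x. ennreal (gaussian_ratio s s' x))"
proof -
  let ?C = "\<lambda>s. (2 * pi * s\<^sup>2) powr (- real DIM('a) / 2)"
  have "?C s' = ?C s * (s / s') powr DIM('a)"
  proof -
    let ?p = "real DIM('a) / 2"
    have "(s / s') powr DIM('a) = (s / s') powr (2 * ?p)" by simp
    also have "\<dots> = ((s / s') powr 2) powr ?p" by (simp only: powr_powr)
    also have "(s / s') powr 2 = (2 * pi * s\<^sup>2) / (2 * pi * s'\<^sup>2)"
      using s by (simp add: power_divide)
    finally show ?thesis
      using powr_uminus_mult_powr_divide[of "2 * pi * s\<^sup>2" "2 * pi * s'\<^sup>2" ?p] s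
      by (simp only: minus_divide_left) simp
  qed
  moreover have "exp (- (norm x)\<^sup>2 / (2 * s'\<^sup>2)) = exp (- (norm x)\<^sup>2 / (2 * s\<^sup>2)) *
      exp (- (1 / (2 * s'\<^sup>2) - 1 / (2 * s\<^sup>2)) * (norm x)\<^sup>2)" for x :: 'a
  proof -
    have "- (norm x)\<^sup>2 / (2 * s'\<^sup>2) = - (norm x)\<^sup>2 / (2 * s\<^sup>2) +
        - (1 / (2 * s'\<^sup>2) - 1 / (2 * s\<^sup>2)) * (norm x)\<^sup>2"
      by (simp add: algebra_simps)
    then show ?thesis by (simp only: exp_add)
  qed
  ultimately have "ennreal (?C s' * exp (- (norm x)\<^sup>2 / (2 * s'\<^sup>2))) =
      ennreal (?C s * exp (- (norm x)\<^sup>2 / (2 * s\<^sup>2))) * ennreal (gaussian_ratio s s' x)" for x :: 'a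
    by (simp add: gaussian_ratio_def mult_ac flip: ennreal_mult)
  then show ?thesis
    unfolding gaussian_K_def by (subst density_density_eq) auto
qed

text \<open>A power of the ratio is again a constant times a Gaussian exponential, with coefficient
  multiplied by \<open>a\<close>. The parameter \<open>z\<close> vanishes for equal variances, and
  \<open>1 + a * z > 0\<close> expresses that the integral is finite.\<close>

lemma nn_integral_gaussian_ratio_powr:
  fixes s s' a :: real
  defines "z \<equiv> (s / s')\<^sup>2 - 1"
  assumes s: "s > 0" "s' > 0" and a: "1 + a * z > 0"
  shows "(\<integral>\<^sup>+x. ennreal (gaussian_ratio s s' x powr a) \<partial>(gaussian_K s :: 'a :: {real_normed_field, euclidean_space} measure)) =
    ennreal ((1 + z) powr (DIM('a) * a / 2) * (1 + a * z) powr (- real DIM('a) / 2))"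
proof -
  define k where "k = 1 / (2 * s'\<^sup>2) - 1 / (2 * s\<^sup>2)"
  have k: "2 * (a * k) * s\<^sup>2 = a * z"
    using s by (simp add: k_def z_def field_simps power2_eq_square)
  have "((s / s') powr DIM('a)) powr a = (s / s') powr (2 * (DIM('a) * a / 2))"
    using s by (simp add: powr_powr)
  also have "\<dots> = ((s / s') powr 2) powr (DIM('a) * a / 2)"
    by (simp only: powr_powr)
  also have "(s / s') powr 2 = 1 + z" using s by (simp add: z_def)
  finally have "gaussian_ratio s s' x powr a =
      (1 + z) powr (DIM('a) * a / 2) * exp (- (a * k) * (norm x)\<^sup>2)" for x :: 'a
    by (simp add: gaussian_ratio_def powr_mult exp_powr_real k_def[symmetric] mult_ac)
  then have "(\<integral>\<^sup>+x. ennreal (gaussian_ratio s s' x powr a) \<partial>(gaussian_K s :: 'a measure)) =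
      (\<integral>\<^sup>+x. ennreal ((1 + z) powr (DIM('a) * a / 2)) * ennreal (exp (- (a * k) * (norm x)\<^sup>2))
        \<partial>(gaussian_K s :: 'a measure))"
    by (simp flip: ennreal_mult)
  also have "\<dots> = ennreal ((1 + z) powr (DIM('a) * a / 2)) *
      (\<integral>\<^sup>+x. ennreal (exp (- (a * k) * (norm x)\<^sup>2)) \<partial>(gaussian_K s :: 'a measure))"
    by (rule nn_integral_cmult) measurable
  also have "(\<integral>\<^sup>+x. ennreal (exp (- (a * k) * (norm x)\<^sup>2)) \<partial>(gaussian_K s :: 'a measure)) =
      ennreal ((1 + a * z) powr (- real DIM('a) / 2))"
    using nn_integral_gaussian_K_exp[of s "a * k", where 'a = 'a] s a by (simp only: k)
  finally show ?thesis by (simp add: ennreal_mult)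
qed

section \<open>Products of positive numbers and square summable deviations from 1\<close>

lemma prod_bounded_if_ln_summable:
  fixes b c :: "nat \<Rightarrow> real"
  assumes b: "\<And>n. b n > 0" and ln_b: "eventually (\<lambda>n. ln (b n) \<le> c n) sequentially"
    and c: "\<And>n. c n \<ge> 0" "summable c"
  obtains K where "\<And>N. (\<Prod>n<N. b n) \<le> K"
proof
  \<comment> \<open>Nothing bounds \<open>ln (b n)\<close> from below, and the upper bound may fail
    for finitely many \<open>n\<close>; positive parts can be compared with
    \<open>c\<close>.\<close>
  define g where "g n = max 0 (ln (b n))" for n
  have "eventually (\<lambda>n. norm (g n) \<le> c n) sequentially"
    using ln_b by eventually_elim (use c(1) in \<open>auto simp: g_def\<close>)
  then have g: "summable g" using c(2) by (rule summable_comparison_test_ev)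
  show "(\<Prod>n<N. b n) \<le> exp (suminf g)" for N
  proof -
    have "(\<Prod>n<N. b n) = exp (\<Sum>n<N. ln (b n))" using b by (simp add: exp_sum)
    also have "(\<Sum>n<N. ln (b n)) \<le> (\<Sum>n<N. g n)" by (intro sum_mono) (simp add: g_def)
    also have "\<dots> \<le> suminf g" using g by (rule sum_le_suminf) (auto simp: g_def)
    finally show ?thesis by simp
  qed
qed

lemma prod_arbitrarily_small_if_ln_not_summable:
  fixes b y :: "nat \<Rightarrow> real"
  assumes b: "\<And>n. b n > 0" and ln_b: "\<And>n. ln (b n) \<le> - y n"
    and y: "\<And>n. y n \<ge> 0" "\<not> summable y" and e: "e > 0"
  shows "\<exists>N. (\<Prod>n<N. b n) \<le> e"
proof -
  have "\<not> (\<forall>N. (\<Sum>n<N. y n) \<le> - ln e)"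
    using summableI_nonneg_bounded[of y "- ln e"] y by auto
  then obtain N where N: "(\<Sum>n<N. y n) > - ln e" by (auto simp: not_le)
  have "(\<Prod>n<N. b n) = exp (\<Sum>n<N. ln (b n))" using b by (simp add: exp_sum)
  also have "(\<Sum>n<N. ln (b n)) \<le> (\<Sum>n<N. - y n)" using ln_b by (intro sum_mono)
  also have "\<dots> \<le> ln e" using N by (simp add: sum_negf)
  finally show ?thesis using e by auto
qed

lemma summable_square_imp_tendsto:
  fixes r :: "nat \<Rightarrow> real"
  assumes "summable (\<lambda>n. (1 - r n)\<^sup>2)"
  shows "r \<longlonglongrightarrow> 1"
proof -
  have "(\<lambda>n. (1 - r n)\<^sup>2) \<longlonglongrightarrow> 0" using assms by (rule summable_LIMSEQ_zero)
  then have "(\<lambda>n. sqrt ((1 - r n)\<^sup>2)) \<longlonglongrightarrow> sqrt 0" by (rule tendsto_real_sqrt)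
  then have "(\<lambda>n. 1 - r n) \<longlonglongrightarrow> 0" by (simp add: tendsto_rabs_zero_iff)
  then have "(\<lambda>n. 1 - (1 - r n)) \<longlonglongrightarrow> 1 - 0" by (intro tendsto_intros)
  then show ?thesis by simp
qed

text \<open>Up to sign, \<open>1 - 1 / r n\<close> is \<open>1 - r n\<close> times
  \<open>1 / r n\<close>, and the latter is eventually at most 2 since \<open>r\<close> tends to 1.
  This is the symmetry between the two measures.\<close>

lemma summable_square_inverse:
  fixes r :: "nat \<Rightarrow> real"
  assumes r: "\<And>n. r n > 0" and s: "summable (\<lambda>n. (1 - r n)\<^sup>2)"
  shows "summable (\<lambda>n. (1 - 1 / r n)\<^sup>2)"
proof (rule summable_comparison_test_ev)
  have "eventually (\<lambda>n. r n > 1 / 2) sequentially"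
    using summable_square_imp_tendsto[OF s] by (rule order_tendstoD) simp
  then show "eventually (\<lambda>n. norm ((1 - 1 / r n)\<^sup>2) \<le> 4 * (1 - r n)\<^sup>2) sequentially"
  proof eventually_elim
    case (elim n)
    have "1 / r n \<le> 2" using elim by (simp add: field_simps)
    then have "(1 / r n)\<^sup>2 \<le> 2\<^sup>2" using r[of n] by (intro power_mono) auto
    moreover have "(1 - 1 / r n)\<^sup>2 = (1 / r n)\<^sup>2 * (1 - r n)\<^sup>2"
      using r[of n] by (simp add: field_simps power2_eq_square)
    ultimately show ?case by (simp add: mult_right_mono del: power_divide)
  qed
  show "summable (\<lambda>n. 4 * (1 - r n)\<^sup>2)" using s by (rule summable_mult)
qed

text \<open>Here \<open>r\<close> is not known to be bounded, so the terms tending to 0 must exclude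
  large \<open>r n\<close>. The term equals \<open>1 / 5\<close> at \<open>r n = 2\<close> and is no
  smaller beyond, so eventually \<open>r n < 2\<close> and the denominator is at most 5.\<close>

lemma summable_square_of_relative:
  fixes r :: "nat \<Rightarrow> real"
  assumes r: "\<And>n. r n > 0" and s: "summable (\<lambda>n. (1 - r n)\<^sup>2 / (1 + (r n)\<^sup>2))"
  shows "summable (\<lambda>n. (1 - r n)\<^sup>2)"
proof (rule summable_comparison_test_ev)
  have "eventually (\<lambda>n. (1 - r n)\<^sup>2 / (1 + (r n)\<^sup>2) < 1 / 5) sequentially"
    using summable_LIMSEQ_zero[OF s] by (rule order_tendstoD) simp
  then show "eventually (\<lambda>n. norm ((1 - r n)\<^sup>2) \<le> 5 * ((1 - r n)\<^sup>2 / (1 + (r n)\<^sup>2))) sequentially"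
  proof eventually_elim
    case (elim n)
    have pos: "1 + (r n)\<^sup>2 > 0" by (simp add: add_pos_nonneg)
    have "5 * (1 - r n)\<^sup>2 < 1 + (r n)\<^sup>2"
      using elim pos by (simp add: divide_less_eq)
    then have "2 * (r n - 2) * (2 * r n - 1) < 0"
      by (simp add: power2_eq_square algebra_simps)
    then have "r n < 2" by (rule contrapos_pp) (simp add: not_less mult_nonneg_nonneg)
    then have "(r n)\<^sup>2 \<le> 2\<^sup>2" using r[of n] by (intro power_mono) auto
    then have "(1 + (r n)\<^sup>2) * (1 - r n)\<^sup>2 \<le> 5 * (1 - r n)\<^sup>2" by (intro mult_right_mono) auto
    then show ?case using pos by (simp add: pos_le_divide_eq mult_ac)
  qed
  show "summable (\<lambda>n. 5 * ((1 - r n)\<^sup>2 / (1 + (r n)\<^sup>2)))" using s by (rule summable_mult)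
qed

section \<open>The dichotomy for two Gaussian products\<close>

lemma product_density_gaussian:
  fixes su sv :: "nat \<Rightarrow> real"
  assumes "\<And>n. su n > 0" "\<And>n. sv n > 0"
  shows "product_density (\<lambda>n. gaussian_K (su n) :: 'a :: {real_normed_field, euclidean_space} measure)
    (\<lambda>n. gaussian_ratio (su n) (sv n))"
proof (rule product_density.intro)
  show "gaussian_ratio (su n) (sv n) \<in> borel_measurable (gaussian_K (su n) :: 'a measure)" for n
    by measurable
qed (use assms in \<open>simp_all add: prob_space_gaussian_K gaussian_ratio_nonneg
      flip: gaussian_K_eq_density\<close>)

lemma gaussian_product_density:
  fixes su sv :: "nat \<Rightarrow> real"
  assumes "\<And>n. su n > 0" "\<And>n. sv n > 0"
  shows "(\<Pi>\<^sub>M n\<in>UNIV. density (gaussian_K (su n)) (gaussian_ratio (su n) (sv n))) =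
    (gaussian_product sv :: (nat \<Rightarrow> 'a :: {real_normed_field, euclidean_space}) measure)"
  unfolding gaussian_product_def using assms by (simp flip: gaussian_K_eq_density)

lemma absolutely_continuous_gaussian_product:
  fixes su sv :: "nat \<Rightarrow> real"
  assumes su: "\<And>n. su n > 0" and sv: "\<And>n. sv n > 0"
    and sum: "summable (\<lambda>n. (1 - sv n / su n)\<^sup>2)"
  shows "absolutely_continuous (gaussian_product su)
    (gaussian_product sv :: (nat \<Rightarrow> 'a :: {real_normed_field, euclidean_space}) measure)"
proof -
  interpret product_density "\<lambda>n. gaussian_K (su n) :: 'a measure"
    "\<lambda>n. gaussian_ratio (su n) (sv n)"
    using su sv by (rule product_density_gaussian)
  define r where "r n = sv n / su n" for n
  define z where "z n = (su n / sv n)\<^sup>2 - 1" for n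
  have r: "r n > 0" for n using su sv by (simp add: r_def)
  have z_r: "z n = (1 / r n)\<^sup>2 - 1" for n by (simp add: z_def r_def power_divide)
  have sum_inv: "summable (\<lambda>n. (1 - 1 / r n)\<^sup>2)"
    using sum by (intro summable_square_inverse r) (simp add: r_def)
  have lim: "r \<longlonglongrightarrow> 1" and lim_inv: "(\<lambda>n. 1 / r n) \<longlonglongrightarrow> 1"
    using summable_square_imp_tendsto[OF sum] summable_square_imp_tendsto[OF sum_inv]
    by (simp_all add: r_def[abs_def])
  obtain B where B: "B > 0" "\<And>n. norm (r n) \<le> B"
    using convergent_imp_Bseq[OF convergentI[OF lim]] unfolding Bseq_def by blast
  \<comment> \<open>From \<open>(r n)\<^sup>2 \<le> B\<^sup>2\<close> follows
    \<open>(a - 1) * (r n)\<^sup>2 \<le> 1 < a\<close>, which is \<open>1 + a * z n > 0\<close> for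
    every \<open>n\<close>, the early ones included.\<close>
  define a where "a = 1 + 1 / B\<^sup>2"
  have a: "a > 1" using B(1) by (simp add: a_def)
  have az: "1 + a * z n > 0" for n
  proof -
    have "(r n)\<^sup>2 \<le> B\<^sup>2" using B(2)[of n] r[of n] by (intro power_mono) auto
    then have "(a - 1) * (r n)\<^sup>2 < a"
      using B(1) a by (simp add: a_def divide_simps)
    moreover have zr: "z n * (r n)\<^sup>2 = 1 - (r n)\<^sup>2"
      using r[of n] by (simp add: z_r power_divide left_diff_distrib)
    have "(1 + a * z n) * (r n)\<^sup>2 = (r n)\<^sup>2 + a * (z n * (r n)\<^sup>2)"
      by (simp add: algebra_simps)
    then have "(1 + a * z n) * (r n)\<^sup>2 = a - (a - 1) * (r n)\<^sup>2"
      unfolding zr by (simp add: algebra_simps)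
    ultimately have "(1 + a * z n) * (r n)\<^sup>2 > 0" by linarith
    then show ?thesis by (simp add: zero_less_mult_iff)
  qed
  have z1: "1 + z n > 0" for n using su[of n] sv[of n] by (simp add: z_def)
  let ?d = "real DIM('a)"
  define b where "b n = (1 + z n) powr (?d * a / 2) * (1 + a * z n) powr (- ?d / 2)" for n
  have b: "b n > 0" for n using z1[of n] az[of n] by (simp add: b_def)
  have "z \<longlonglongrightarrow> 1\<^sup>2 - 1" unfolding z_r by (intro tendsto_intros lim_inv)
  then have "(\<lambda>n. \<bar>a * z n\<bar>) \<longlonglongrightarrow> \<bar>a * (1\<^sup>2 - 1)\<bar>" by (intro tendsto_intros)
  then have "eventually (\<lambda>n. \<bar>a * z n\<bar> < 1 / 2) sequentially"
    by (rule order_tendstoD) simp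
  moreover have "eventually (\<lambda>n. 1 / r n < 2) sequentially"
    using lim_inv by (rule order_tendstoD) simp
  ultimately have "eventually (\<lambda>n. ln (b n) \<le> (9 * ?d * a\<^sup>2) * (1 - 1 / r n)\<^sup>2) sequentially"
  proof eventually_elim
    case (elim n)
    \<comment> \<open>The first logarithm lies below its linear part and the second at most
      \<open>2 * (a * z n)\<^sup>2\<close> below its own; the linear parts \<open>a * z n\<close>
      agree.\<close>
    have "ln (1 + a * z n) \<ge> a * z n - 2 * (a * z n)\<^sup>2"
      using abs_ln_one_plus_x_minus_x_bound[of "a * z n"] elim by linarith
    moreover have "a * ln (1 + z n) \<le> a * z n"
      using ln_le_minus_one[OF z1[of n]] a by (intro mult_left_mono) auto
    ultimately have "a * ln (1 + z n) - ln (1 + a * z n) \<le> 2 * (a * z n)\<^sup>2" by linarith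
    then have "?d / 2 * (a * ln (1 + z n) - ln (1 + a * z n)) \<le> ?d / 2 * (2 * (a * z n)\<^sup>2)"
      by (intro mult_left_mono) auto
    moreover have "ln (b n) = ?d / 2 * (a * ln (1 + z n) - ln (1 + a * z n))"
      using z1[of n] az[of n] by (simp add: b_def ln_mult_pos ln_powr algebra_simps)
    ultimately have "ln (b n) \<le> ?d / 2 * (2 * (a * z n)\<^sup>2)" by (simp only:)
    also have "\<dots> = ?d * a\<^sup>2 * (z n)\<^sup>2" by (simp add: power_mult_distrib)
    \<comment> \<open>As a difference of squares, \<open>z n\<close> has the factor
      \<open>1 + 1 / r n\<close>, which is below 3.\<close>
    also have "\<dots> \<le> ?d * a\<^sup>2 * (3\<^sup>2 * (1 - 1 / r n)\<^sup>2)"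
    proof (rule mult_left_mono)
      have "(z n)\<^sup>2 = (1 + 1 / r n)\<^sup>2 * (1 - 1 / r n)\<^sup>2"
        by (simp add: z_r power2_eq_square algebra_simps)
      also have "\<dots> \<le> 3\<^sup>2 * (1 - 1 / r n)\<^sup>2"
        using elim r[of n] by (intro mult_right_mono power_mono) auto
      finally show "(z n)\<^sup>2 \<le> 3\<^sup>2 * (1 - 1 / r n)\<^sup>2" .
    qed simp
    finally show ?case by simp
  qed
  moreover have "summable (\<lambda>n. (9 * ?d * a\<^sup>2) * (1 - 1 / r n)\<^sup>2)"
    using sum_inv by (rule summable_mult)
  ultimately obtain K where K: "\<And>N. (\<Prod>n<N. b n) \<le> K"
    using prod_bounded_if_ln_summable[of b "\<lambda>n. (9 * ?d * a\<^sup>2) * (1 - 1 / r n)\<^sup>2"] b by auto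
  have "absolutely_continuous P Q"
  proof (rule absolutely_continuous_product[OF a])
    fix N
    have "(\<Prod>n<N. \<integral>\<^sup>+x. ennreal (gaussian_ratio (su n) (sv n) x powr a) \<partial>(gaussian_K (su n) :: 'a measure)) =
        (\<Prod>n<N. ennreal (b n))"
      using az su sv by (intro prod.cong refl)
        (simp add: b_def z_def nn_integral_gaussian_ratio_powr del: minus_divide_left)
    also have "\<dots> \<le> ennreal K"
      using K b by (simp add: prod_ennreal less_imp_le ennreal_leI)
    finally show "(\<Prod>n<N. \<integral>\<^sup>+x. ennreal (gaussian_ratio (su n) (sv n) x powr a) \<partial>(gaussian_K (su n) :: 'a measure))
      \<le> ennreal K" .
  qed
  then show ?thesis
    using gaussian_product_density[OF su sv, where 'a = 'a] by (simp add: gaussian_product_def)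
qed

lemma mutually_singular_gaussian_product:
  fixes su sv :: "nat \<Rightarrow> real"
  assumes su: "\<And>n. su n > 0" and sv: "\<And>n. sv n > 0"
    and sum: "\<not> summable (\<lambda>n. (1 - sv n / su n)\<^sup>2)"
  shows "mutually_singular (gaussian_product su)
    (gaussian_product sv :: (nat \<Rightarrow> 'a :: {real_normed_field, euclidean_space}) measure)"
proof -
  interpret product_density "\<lambda>n. gaussian_K (su n) :: 'a measure"
    "\<lambda>n. gaussian_ratio (su n) (sv n)"
    using su sv by (rule product_density_gaussian)
  define r where "r n = sv n / su n" for n
  define z where "z n = (su n / sv n)\<^sup>2 - 1" for n
  have r: "r n > 0" for n using su sv by (simp add: r_def)
  have z_r: "z n = (1 / r n)\<^sup>2 - 1" for n by (simp add: z_def r_def power_divide)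
  have z1: "1 + z n > 0" and z2: "1 + 1 / 2 * z n > 0" for n
    using su[of n] sv[of n] by (simp_all add: z_def add_pos_pos field_simps)
  let ?d = "real DIM('a)"
  define b where "b n = (1 + z n) powr (?d * (1/2) / 2) * (1 + 1 / 2 * z n) powr (- ?d / 2)" for n
  define y where "y n = (1 - r n)\<^sup>2 / (1 + (r n)\<^sup>2)" for n
  have y_nonneg: "y n \<ge> 0" for n by (simp add: y_def)
  have b: "b n > 0" for n using z1[of n] z2[of n] by (simp add: b_def)
  have ln_b: "ln (b n) \<le> - (1 / 4 * y n)" for n
  proof -
    \<comment> \<open>Here \<open>b n = q powr (?d / 4)\<close>. The estimate
      \<open>ln q \<le> q - 1\<close> is good enough for every \<open>n\<close>, however far
      \<open>r n\<close> is from 1.\<close>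
    define q where "q = (1 + z n) / (1 + 1 / 2 * z n)\<^sup>2"
    have q_pos: "q > 0" using z1[of n] z2[of n] by (simp add: q_def)
    have pos: "1 + (r n)\<^sup>2 > 0" by (simp add: add_pos_nonneg)
    have "1 + z n = 1 / (r n)\<^sup>2" "1 + 1 / 2 * z n = (1 + (r n)\<^sup>2) / (2 * (r n)\<^sup>2)"
      using r[of n] by (simp_all add: z_r power_divide field_simps)
    then have "q = 4 * (r n)\<^sup>2 / (1 + (r n)\<^sup>2)\<^sup>2"
      using r[of n] by (simp add: q_def power2_eq_square)
    then have "q - 1 = - ((1 - (r n)\<^sup>2)\<^sup>2 / (1 + (r n)\<^sup>2)\<^sup>2)"
      using pos by (simp add: divide_simps) (simp add: power2_eq_square algebra_simps)
    also have "(1 - (r n)\<^sup>2)\<^sup>2 = (1 - r n)\<^sup>2 * (1 + r n)\<^sup>2"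
      by (simp add: power2_eq_square algebra_simps)
    \<comment> \<open>Dropping the cross term of \<open>(1 + r n)\<^sup>2\<close> leaves
      \<open>1 + (r n)\<^sup>2\<close>, which cancels one factor of the denominator and produces
      \<open>y n\<close>.\<close>
    also have "- ((1 - r n)\<^sup>2 * (1 + r n)\<^sup>2 / (1 + (r n)\<^sup>2)\<^sup>2) \<le>
        - ((1 - r n)\<^sup>2 * (1 + (r n)\<^sup>2) / (1 + (r n)\<^sup>2)\<^sup>2)"
    proof -
      have "1 + (r n)\<^sup>2 \<le> (1 + r n)\<^sup>2"
        using r[of n] by (simp add: power2_eq_square algebra_simps)
      then show ?thesis
        by (intro le_imp_neg_le divide_right_mono mult_left_mono) auto
    qed
    also have "\<dots> = - y n" using pos by (simp add: y_def power2_eq_square)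
    finally have "ln q \<le> - y n" using ln_le_minus_one[OF q_pos] by linarith
    then have "?d / 4 * ln q \<le> ?d / 4 * (- y n)" by (intro mult_left_mono) auto
    moreover have "ln (b n) = ?d / 4 * ln q"
      using z1[of n] z2[of n]
      by (simp add: b_def q_def ln_mult_pos ln_div ln_powr ln_realpow algebra_simps)
    ultimately have "ln (b n) \<le> ?d / 4 * (- y n)" by (simp only:)
    also have "\<dots> \<le> 1 / 4 * (- y n)"
      using y_nonneg[of n] DIM_positive[where 'a = 'a] by (intro mult_right_mono_neg) auto
    finally show ?thesis by simp
  qed
  have "\<not> summable (\<lambda>n. 1 / 4 * y n)"
  proof
    assume "summable (\<lambda>n. 1 / 4 * y n)"
    then have "summable y" by (subst (asm) summable_cmult_iff) auto
    then have "summable (\<lambda>n. (1 - r n)\<^sup>2)"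
      unfolding y_def by (intro summable_square_of_relative r)
    with sum show False by (simp add: r_def)
  qed
  have "mutually_singular P Q"
  proof (rule mutually_singular_product)
    fix e :: real assume "e > 0"
    then obtain N where N: "(\<Prod>n<N. b n) \<le> e"
      using prod_arbitrarily_small_if_ln_not_summable[of b "\<lambda>n. 1 / 4 * y n" e]
        b ln_b y_nonneg \<open>\<not> summable (\<lambda>n. 1 / 4 * y n)\<close> by auto
    have "(\<Prod>n<N. \<integral>\<^sup>+x. ennreal (gaussian_ratio (su n) (sv n) x powr (1/2)) \<partial>(gaussian_K (su n) :: 'a measure)) =
        (\<Prod>n<N. ennreal (b n))"
    proof (rule prod.cong[OF refl])
      fix n
      show "(\<integral>\<^sup>+x. ennreal (gaussian_ratio (su n) (sv n) x powr (1/2)) \<partial>(gaussian_K (su n) :: 'a measure)) = ennreal (b n)"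
        using nn_integral_gaussian_ratio_powr[OF su[of n] sv[of n], of "1/2", where 'a = 'a] z2[of n]
        by (simp only: b_def z_def)
    qed
    also have "\<dots> \<le> ennreal e"
      using N b by (simp add: prod_ennreal less_imp_le ennreal_leI)
    finally show "\<exists>N. (\<Prod>n<N. \<integral>\<^sup>+x. ennreal (gaussian_ratio (su n) (sv n) x powr (1/2))
        \<partial>(gaussian_K (su n) :: 'a measure)) \<le> ennreal e" by blast
  qed
  then show ?thesis
    using gaussian_product_density[OF su sv, where 'a = 'a] by (simp add: gaussian_product_def)
qed

section \<open>What invariance under a weighted shift says about the variances\<close>

text \<open>The test function depends on the norm only, so the weight merely rescales its
  coefficient and the law of \<open>w (Suc n) * t (Suc n)\<close> need not be computed. The values
  obtained are strictly monotone in the variance and thus determine it.\<close>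

lemma shift_invariant_gaussian_product_scale:
  fixes w :: "nat \<Rightarrow> 'a :: {real_normed_field, euclidean_space}" and sd :: "nat \<Rightarrow> real"
  assumes sd: "\<And>n. sd n > 0"
    and inv: "shift_invariant (wbshift w) (gaussian_product sd :: (nat \<Rightarrow> 'a) measure)"
  shows "sd n = norm (w (Suc n)) * sd (Suc n)"
proof -
  let ?P = "gaussian_product sd :: (nat \<Rightarrow> 'a) measure"
  have T: "wbshift w \<in> measurable ?P ?P" using inv by (simp add: shift_invariant_def)
  have distr: "distr ?P ?P (wbshift w) = ?P"
    using inv by (intro measure_eqI) (auto simp: shift_invariant_def emeasure_distr)
  have coord: "(\<lambda>t. t k) \<in> measurable ?P (gaussian_K (sd k))" for k
    unfolding gaussian_product_def by (rule measurable_component_singleton) simp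
  then have [measurable]: "(\<lambda>t. t k) \<in> borel_measurable ?P" for k
    by (simp cong: measurable_cong_sets)
  have component: "(\<integral>\<^sup>+t. h (t k) \<partial>?P) = (\<integral>\<^sup>+x. h x \<partial>gaussian_K (sd k))"
    if h: "h \<in> borel_measurable borel" for h :: "'a \<Rightarrow> ennreal" and k
  proof -
    have "h \<in> borel_measurable (gaussian_K (sd k))"
      using h by (simp cong: measurable_cong_sets)
    then have "(\<integral>\<^sup>+t. h (t k) \<partial>?P) =
        (\<integral>\<^sup>+x. h x \<partial>distr ?P (gaussian_K (sd k)) (\<lambda>t. t k))"
      by (subst nn_integral_distr[OF coord]) simp_all
    also have "distr ?P (gaussian_K (sd k)) (\<lambda>t. t k) = gaussian_K (sd k)"
      unfolding gaussian_product_def by (rule distr_PiM_component) (simp_all add: prob_space_gaussian_K sd)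
    finally show ?thesis .
  qed
  let ?E = "\<lambda>c s. (1 + 2 * c * s\<^sup>2) powr (- real DIM('a) / 2)"
  let ?h = "\<lambda>x :: 'a. ennreal (exp (- (1/2) * (norm x)\<^sup>2))"
  let ?c = "(norm (w (Suc n)))\<^sup>2 / 2"
  have "ennreal (?E (1/2) (sd n)) = (\<integral>\<^sup>+x. ?h x \<partial>gaussian_K (sd n))"
    using sd[of n] by (intro nn_integral_gaussian_K_exp[symmetric]) (auto simp: add_pos_nonneg)
  also have "\<dots> = (\<integral>\<^sup>+t. ?h (t n) \<partial>?P)" by (rule component[symmetric, where h = ?h]) measurable
  also have "\<dots> = (\<integral>\<^sup>+t. ?h (t n) \<partial>distr ?P ?P (wbshift w))" by (simp only: distr)
  also have "\<dots> = (\<integral>\<^sup>+t. ?h (wbshift w t n) \<partial>?P)"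
    by (rule nn_integral_distr[OF T]) measurable
  also have "\<dots> = (\<integral>\<^sup>+t. ennreal (exp (- ?c * (norm (t (Suc n)))\<^sup>2)) \<partial>?P)"
    by (simp add: wbshift_def norm_mult power_mult_distrib)
  also have "\<dots> = (\<integral>\<^sup>+x. ennreal (exp (- ?c * (norm (x :: 'a))\<^sup>2)) \<partial>gaussian_K (sd (Suc n)))"
    by (rule component[where h = "\<lambda>x. ennreal (exp (- ?c * (norm x)\<^sup>2))"]) measurable
  also have "\<dots> = ennreal (?E ?c (sd (Suc n)))"
    using sd[of "Suc n"] by (intro nn_integral_gaussian_K_exp) (auto simp: add_pos_nonneg)
  finally have "?E (1/2) (sd n) = ?E ?c (sd (Suc n))" by (simp add: ennreal_inj)
  \<comment> \<open>Raising to the reciprocal exponent undoes the power; both bases are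
    positive.\<close>
  then have "?E (1/2) (sd n) powr (1 / (- real DIM('a) / 2)) =
      ?E ?c (sd (Suc n)) powr (1 / (- real DIM('a) / 2))" by (simp only:)
  then have "1 + 2 * (1/2) * (sd n)\<^sup>2 = 1 + 2 * ?c * (sd (Suc n))\<^sup>2"
    unfolding powr_powr by (simp add: add_nonneg_nonneg)
  then have "(sd n)\<^sup>2 = (norm (w (Suc n)) * sd (Suc n))\<^sup>2" by (simp add: power_mult_distrib)
  then show ?thesis using sd[of n] sd[of "Suc n"] by (simp add: power2_eq_iff_nonneg less_imp_le)
qed

lemma shift_invariant_gaussian_product_prod:
  fixes w :: "nat \<Rightarrow> 'a :: {real_normed_field, euclidean_space}" and sd :: "nat \<Rightarrow> real"
  assumes "\<And>n. sd n > 0"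
    and "shift_invariant (wbshift w) (gaussian_product sd :: (nat \<Rightarrow> 'a) measure)"
  shows "sd 0 = norm (\<Prod>k=1..n. w k) * sd n"
proof (induction n)
  case (Suc n)
  then show ?case
    using shift_invariant_gaussian_product_scale[OF assms, of n]
    by (simp add: prod.nat_ivl_Suc' norm_mult mult_ac)
qed simp

theorem theorem5p7:
  fixes u v :: "nat \<Rightarrow> 'a::{real_normed_field, euclidean_space}"
    and su sv :: "nat \<Rightarrow> real"
  assumes u_nz: "\<And>n. n \<ge> 1 \<Longrightarrow> u n \<noteq> 0"
    and v_nz: "\<And>n. n \<ge> 1 \<Longrightarrow> v n \<noteq> 0"
    and su_pos: "\<And>n. su n > 0"
    and sv_pos: "\<And>n. sv n > 0"
    and inv_u: "shift_invariant (wbshift u) (gaussian_product su :: (nat \<Rightarrow> 'a) measure)"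
    and inv_v: "shift_invariant (wbshift v) (gaussian_product sv :: (nat \<Rightarrow> 'a) measure)"
  shows "(measures_equivalent (gaussian_product su) (gaussian_product sv :: (nat \<Rightarrow> 'a) measure)
          \<or> mutually_singular (gaussian_product su) (gaussian_product sv :: (nat \<Rightarrow> 'a) measure))
       \<and> (measures_equivalent (gaussian_product su) (gaussian_product sv :: (nat \<Rightarrow> 'a) measure)
          \<longleftrightarrow> summable (\<lambda>n. (1 - (sv 0 / su 0) *
                 (norm (\<Prod>k=1..Suc n. u k) / norm (\<Prod>k=1..Suc n. v k)))\<^sup>2))"
proof -
  let ?P = "gaussian_product su :: (nat \<Rightarrow> 'a) measure"
  let ?Q = "gaussian_product sv :: (nat \<Rightarrow> 'a) measure"
  let ?r = "\<lambda>n. sv n / su n"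
  have "sv 0 / su 0 * (norm (\<Prod>k=1..n. u k) / norm (\<Prod>k=1..n. v k)) = ?r n" for n
  proof -
    have "(\<Prod>k=1..n. u k) \<noteq> 0" "(\<Prod>k=1..n. v k) \<noteq> 0" using u_nz v_nz by auto
    then show ?thesis
      using shift_invariant_gaussian_product_prod[OF su_pos inv_u, of n]
        shift_invariant_gaussian_product_prod[OF sv_pos inv_v, of n]
      by (simp del: prod_zero_iff)
  qed
  \<comment> \<open>The identity holds from \<open>n = 0\<close> on, whereas the series starts at 1;
    the missing term does not affect summability.\<close>
  then have series: "summable (\<lambda>n. (1 - (sv 0 / su 0) *
      (norm (\<Prod>k=1..Suc n. u k) / norm (\<Prod>k=1..Suc n. v k)))\<^sup>2) \<longleftrightarrow> summable (\<lambda>n. (1 - ?r n)\<^sup>2)"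
    using summable_Suc_iff[of "\<lambda>n. (1 - ?r n)\<^sup>2"] by (simp only:)
  \<comment> \<open>Each direction of absolute continuity is one use of the moment criterion;
    exchanging \<open>su\<close> and \<open>sv\<close> inverts \<open>?r\<close>.\<close>
  have equivalent: "measures_equivalent ?P ?Q" if sum: "summable (\<lambda>n. (1 - ?r n)\<^sup>2)"
  proof -
    have "summable (\<lambda>n. (1 - 1 / ?r n)\<^sup>2)"
      using sum su_pos sv_pos by (intro summable_square_inverse) simp_all
    then have "summable (\<lambda>n. (1 - su n / sv n)\<^sup>2)" by simp
    then show ?thesis
      using sum su_pos sv_pos
      by (simp add: measures_equivalent_def absolutely_continuous_gaussian_product)
  qed
  have singular: "mutually_singular ?P ?Q" if "\<not> summable (\<lambda>n. (1 - ?r n)\<^sup>2)"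
    using su_pos sv_pos that by (rule mutually_singular_gaussian_product)
  have "prob_space ?Q"
    unfolding gaussian_product_def by (intro prob_space_PiM prob_space_gaussian_K sv_pos)
  moreover have "sets ?Q = sets ?P" unfolding gaussian_product_def by (simp cong: sets_PiM_cong)
  ultimately have "\<not> mutually_singular ?P ?Q" if "measures_equivalent ?P ?Q"
    using that mutually_singular_not_absolutely_continuous
    by (auto simp: measures_equivalent_def)
  then show ?thesis using equivalent singular unfolding series by blast
qed

end
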